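(* Let $v:\{0,1\}^d\to\mathbb{R}$ be a cooperative game, and let $Z\sim p$ be the random binary vector distributed according to the normalized Shapley kernel. Let $\bar\beta_{2n}$ be the unbiased KernelSHAP estimator based on $2n$ independent samples from $p$, and let $\check\beta_n$ be the paired-sampling estimator based on $n$ independent samples from $p$ (each paired with its complement). The difference between the covariance matrices of these estimators is given by $$\mathrm{Cov}(\bar\beta_{2n})-\mathrm{Cov}(\check\beta_n)=\frac{1}{2n}\,C\,G_v\,C^T,$$ where $G_v$ is a property of the game $v$, defined as $$G_v=-\mathrm{Cov}\big(Zv(Z),\,(\mathbf 1-Z)\,v(\mathbf 1-Z)\big).$$ For sufficiently large $n$, $G_v\succeq 0$ (i.e. $G_v$ positive semi-definite) guarantees that the Gaussian confidence ellipsoid $\bar E_{2n,\alpha}$ for $\bar\beta_{2n}$ contains the corresponding confidence ellipsoid $\check E_{n,\alpha}$ for $\check\beta_n$, that is, $\check E_{n,\alpha}\subseteq\bar E_{2n,\alpha}$, at any confidence level $\alpha\in(0,1)$.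
   Context: Let $D=\{1,\dots,d\}$, $d\ge2$. A cooperative game is a function $v$ assigning a real number to each subset $S\subseteq D$; subsets are identified with vectors $z\in\{0,1\}^d$ via $S=\{i:z_i=1\}$. $\mathbf 0$ and $\mathbf 1$ are the all-zeros and all-ones vectors in $\mathbb{R}^d$. Distribution $p$ on $\{0,1\}^d$: $p(z)\propto \mu(z)=\dfrac{d-1}{\binom{d}{k}k(d-k)}$ with $k=\mathbf 1^Tz$ when $0<k<d$, and $p(z)=0$ otherwise. $Z$ denotes a random vector with law $p$. Let $A=\mathbb{E}[ZZ^T]\in\mathbb{R}^{d\times d}$ and $$C=A^{-1}-\frac{A^{-1}\mathbf 1\mathbf 1^TA^{-1}}{\mathbf 1^TA^{-1}\mathbf 1}.$$ For $c\in\mathbb{R}^d$ put $$\mathcal B(c)=A^{-1}\Big(c-\mathbf 1\,\frac{\mathbf 1^TA^{-1}c-v(\mathbf 1)+v(\mathbf 0)}{\mathbf 1^TA^{-1}\mathbf 1}\Big).$$ Let $\beta^*=\mathcal B(b)$ with $b=\mathbb{E}[Z(v(Z)-v(\mathbf 0))]$; this is the vector of Shapley values of $v$. For independent samples $z_1,z_2,\ldots\sim p$: - unbiased KernelSHAP: $\bar b_n=\frac1n\sum_{i=1}^n z_iv(z_i)-\mathbb{E}[Z]\,v(\mathbf 0)$ and $\bar\beta_n=\mathcal B(\bar b_n)$; - paired sampling: $\check b_n=\frac1{2n}\sum_{i=1}^n\big(z_iv(z_i)+(\mathbf 1-z_i)v(\mathbf 1-z_i)-v(\mathbf 0)\mathbf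 1\big)$ and $\check\beta_n=\mathcal B(\check b_n)$. For random vectors $X,Y\in\mathbb{R}^d$, $\mathrm{Cov}(X,Y)=\mathbb{E}[XY^T]-\mathbb{E}[X]\mathbb{E}[Y]^T$ and $\mathrm{Cov}(X)=\mathrm{Cov}(X,X)$. Confidence ellipsoids: with $\chi^2_d(\alpha)$ denoting the inverse CDF, evaluated at $\alpha$, of the chi-squared distribution with $d$ degrees of freedom, for $\alpha\in(0,1)$ define $$\bar E_{2n,\alpha}=\Big\{a\in\mathbb{R}^d:(a-\beta^* )^T\,\mathrm{Cov}(\bar\beta_{2n})^{-1}(a-\beta^* )\le\sqrt{\chi^2_d(\alpha)}\Big\},$$ $$\check E_{n,\alpha}=\Big\{a\in\mathbb{R}^d:(a-\beta^* )^T\,\mathrm{Cov}(\check\beta_{n})^{-1}(a-\beta^* )\le\sqrt{\chi^2_d(\alpha)}\Big\}.$$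
   Formalization: The entries of both estimators always sum to v(1)-v(0), so their covariances are singular and Cov^{-1} does not exist; the ellipsoids are taken with the Moore-Penrose inverse of Cov, restricted to the support β* + range(Cov). *)

theory Defs
  imports "HOL-Probability.Probability"
begin

text \<open>
  The player set \<open>D = {1,\<dots>,d}\<close> is the finite index type \<open>'n\<close>, so \<open>d = CARD('n)\<close>.  A binary vector
  \<open>z \<in> {0,1}\<^sup>d\<close> is represented by its coalition \<open>S :: 'n set\<close>, and \<open>bits S\<close> is that vector as an
  element of \<open>\<real>\<^sup>d\<close>.  Thus \<open>\<zero>\<close>, \<open>\<one>\<close> and \<open>\<one> - z\<close> correspond to \<open>{}\<close>, \<open>UNIV\<close> and \<open>- S\<close>, and a
  game is a function \<open>v :: 'n set \<Rightarrow> real\<close>.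
\<close>

definition bits :: "'n::finite set \<Rightarrow> real ^ 'n" where
  "bits S = (\<chi> i. if i \<in> S then 1 else 0)"

lemma bits_empty: "bits {} = 0"
  by (simp add: bits_def vec_eq_iff)

lemma bits_UNIV: "bits UNIV = 1"
  by (simp add: bits_def vec_eq_iff)

lemma bits_Compl: "bits (- S) = 1 - bits S"
  by (simp add: bits_def vec_eq_iff)

definition outer :: "real ^ 'm \<Rightarrow> real ^ 'n \<Rightarrow> real ^ 'n ^ 'm" where
  "outer x y = (\<chi> i j. x $ i * y $ j)"

definition psd :: "real ^ 'n ^ 'n \<Rightarrow> bool" where
  "psd G \<longleftrightarrow> transpose G = G \<and> (\<forall>x. 0 \<le> x \<bullet> (G *v x))"

definition Cov :: "'a measure \<Rightarrow> ('a \<Rightarrow> real ^ 'n) \<Rightarrow> ('a \<Rightarrow> real ^ 'n) \<Rightarrow> real ^ 'n ^ 'n" where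
  "Cov M X Y = (\<integral>\<omega>. outer (X \<omega>) (Y \<omega>) \<partial>M) - outer (\<integral>\<omega>. X \<omega> \<partial>M) (\<integral>\<omega>. Y \<omega> \<partial>M)"

definition shapley_weight :: "'n::finite set \<Rightarrow> real" where
  "shapley_weight S =
     (let d = CARD('n); k = card S in
      if 0 < k \<and> k < d
      then (real d - 1) / (real (d choose k) * real k * (real d - real k)) else 0)"

definition shapley_kernel :: "'n::finite set pmf" where
  "shapley_kernel =
     embed_pmf (\<lambda>S. shapley_weight S / (\<Sum>T\<in>UNIV. shapley_weight (T :: 'n set)))"

lemma shapley_weight_nonneg: "0 \<le> shapley_weight (S :: 'n::finite set)"
  by (auto simp: shapley_weight_def Let_def)

lemma sum_shapley_weight_pos:
  assumes "CARD('n::finite) \<ge> 2"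
  shows "0 < (\<Sum>T\<in>UNIV. shapley_weight (T :: 'n set))"
proof -
  fix i :: 'n
  have "0 < real (CARD('n) choose 1)"
    using assms by simp
  then have "0 < shapley_weight {i}"
    using assms by (simp add: shapley_weight_def)
  also have "\<dots> \<le> (\<Sum>T\<in>UNIV. shapley_weight (T :: 'n set))"
    by (rule member_le_sum) (auto simp: shapley_weight_nonneg)
  finally show ?thesis .
qed

lemma pmf_shapley_kernel:
  assumes "CARD('n::finite) \<ge> 2"
  shows "pmf shapley_kernel (S :: 'n set) =
    shapley_weight S / (\<Sum>T\<in>UNIV. shapley_weight (T :: 'n set))"
  unfolding shapley_kernel_def
proof (rule pmf_embed_pmf)
  let ?s = "\<Sum>T\<in>UNIV. shapley_weight (T :: 'n set)"
  show nn: "0 \<le> shapley_weight S / ?s" for S :: "'n set"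
    by (simp add: shapley_weight_nonneg sum_nonneg)
  have "(\<integral>\<^sup>+S. ennreal (shapley_weight S / ?s) \<partial>count_space (UNIV :: 'n set set))
      = ennreal (\<Sum>S\<in>UNIV. shapley_weight (S :: 'n set) / ?s)"
    using nn by (simp add: nn_integral_count_space_finite sum_ennreal)
  also have "(\<Sum>S\<in>UNIV. shapley_weight (S :: 'n set) / ?s) = 1"
    using sum_shapley_weight_pos[OF assms] by (simp flip: sum_divide_distrib)
  finally show "(\<integral>\<^sup>+S. ennreal (shapley_weight S / ?s) \<partial>count_space (UNIV :: 'n set set)) = 1"
    by simp
qed

definition A_mat :: "real ^ 'n ^ 'n::finite" where
  "A_mat = measure_pmf.expectation shapley_kernel
     (\<lambda>S :: 'n set. outer (bits S) (bits S))"

definition C_mat :: "real ^ 'n ^ 'n::finite" where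
  "C_mat = (let A1 = matrix_inv A_mat in
     A1 - (1 / (1 \<bullet> (A1 *v 1))) *\<^sub>R (A1 ** outer 1 1 ** A1))"

text \<open>
  The minimiser of \<open>x \<bullet> (A *v x) - 2 * (x \<bullet> c)\<close> subject to \<open>1 \<bullet> x = v UNIV - v {}\<close>; at the exact
  \<open>b_exact v\<close> it is the vector of Shapley values of \<open>v\<close>, called \<open>beta_star v\<close>.
\<close>

definition solution_of :: "('n::finite set \<Rightarrow> real) \<Rightarrow> real ^ 'n \<Rightarrow> real ^ 'n" where
  "solution_of v c = (let A1 = matrix_inv A_mat in
     A1 *v (c - ((1 \<bullet> (A1 *v c) - v UNIV + v {}) / (1 \<bullet> (A1 *v 1))) *\<^sub>R 1))"

definition b_exact :: "('n::finite set \<Rightarrow> real) \<Rightarrow> real ^ 'n" where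
  "b_exact v = measure_pmf.expectation shapley_kernel (\<lambda>S. (v S - v {}) *\<^sub>R bits S)"

definition beta_star :: "('n::finite set \<Rightarrow> real) \<Rightarrow> real ^ 'n" where
  "beta_star v = solution_of v (b_exact v)"

text \<open>The samples are \<open>z 1, z 2, \<dots>\<close>, each \<open>z i\<close> being a random coalition.\<close>

definition b_unbiased ::
  "('n::finite set \<Rightarrow> real) \<Rightarrow> (nat \<Rightarrow> 'a \<Rightarrow> 'n set) \<Rightarrow> nat \<Rightarrow> 'a \<Rightarrow> real ^ 'n" where
  "b_unbiased v z n \<omega> =
     (1 / real n) *\<^sub>R (\<Sum>i=1..n. v (z i \<omega>) *\<^sub>R bits (z i \<omega>))
     - v {} *\<^sub>R measure_pmf.expectation shapley_kernel bits"

definition b_paired ::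
  "('n::finite set \<Rightarrow> real) \<Rightarrow> (nat \<Rightarrow> 'a \<Rightarrow> 'n set) \<Rightarrow> nat \<Rightarrow> 'a \<Rightarrow> real ^ 'n" where
  "b_paired v z n \<omega> =
     (1 / (2 * real n)) *\<^sub>R (\<Sum>i=1..n. (v (z i \<omega>) *\<^sub>R bits (z i \<omega>)
        + v (- z i \<omega>) *\<^sub>R bits (- z i \<omega>) - v {} *\<^sub>R 1))"

definition beta_unbiased ::
  "('n::finite set \<Rightarrow> real) \<Rightarrow> (nat \<Rightarrow> 'a \<Rightarrow> 'n set) \<Rightarrow> nat \<Rightarrow> 'a \<Rightarrow> real ^ 'n" where
  "beta_unbiased v z n \<omega> = solution_of v (b_unbiased v z n \<omega>)"

definition beta_paired ::
  "('n::finite set \<Rightarrow> real) \<Rightarrow> (nat \<Rightarrow> 'a \<Rightarrow> 'n set) \<Rightarrow> nat \<Rightarrow> 'a \<Rightarrow> real ^ 'n" where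
  "beta_paired v z n \<omega> = solution_of v (b_paired v z n \<omega>)"

definition G_mat :: "('n::finite set \<Rightarrow> real) \<Rightarrow> real ^ 'n ^ 'n" where
  "G_mat v = - Cov (measure_pmf shapley_kernel)
     (\<lambda>S. v S *\<^sub>R bits S) (\<lambda>S. v (- S) *\<^sub>R bits (- S))"

definition chi_squared :: "nat \<Rightarrow> real measure" where
  "chi_squared d = density lborel (\<lambda>x. ennreal
     (if 0 < x then x powr (real d / 2 - 1) * exp (- x / 2) / (2 powr (real d / 2) * Gamma (real d / 2))
      else 0))"

definition chi_squared_quantile :: "nat \<Rightarrow> real \<Rightarrow> real" where
  "chi_squared_quantile d \<alpha> = Inf {x. \<alpha> \<le> cdf (chi_squared d) x}"

text \<open>
  The entries of both estimators always sum to \<open>v UNIV - v {}\<close>, so their covariance matrices are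
  singular for every game and have no inverse.  The inverse in the ellipsoid is therefore that of
  a degenerate Gaussian law with mean \<open>m\<close> and covariance \<open>S\<close>: the Moore-Penrose inverse of \<open>S\<close>, on
  the support \<open>m + range S\<close> of the law.  For invertible \<open>S\<close> this is the usual ellipsoid with
  \<open>matrix_inv S\<close> (lemma \<open>confidence_ellipsoid_invertible\<close>).
\<close>

definition is_pinv :: "real ^ 'n ^ 'm \<Rightarrow> real ^ 'm ^ 'n \<Rightarrow> bool" where
  "is_pinv A X \<longleftrightarrow> A ** X ** A = A \<and> X ** A ** X = X \<and>
     transpose (A ** X) = A ** X \<and> transpose (X ** A) = X ** A"

definition pinv :: "real ^ 'n ^ 'm \<Rightarrow> real ^ 'm ^ 'n" where
  "pinv A = (THE X. is_pinv A X)"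

definition confidence_ellipsoid ::
  "real ^ 'n::finite \<Rightarrow> real ^ 'n ^ 'n \<Rightarrow> real \<Rightarrow> (real ^ 'n) set" where
  "confidence_ellipsoid m S \<alpha> =
     {a. a - m \<in> range ((*v) S) \<and>
         (a - m) \<bullet> (pinv S *v (a - m)) \<le> sqrt (chi_squared_quantile CARD('n) \<alpha>)}"

lemma is_pinv_unique:
  assumes X: "is_pinv A X" and Y: "is_pinv A Y"
  shows "X = Y"
proof -
  have "A ** X = transpose (A ** X)"
    using X by (simp add: is_pinv_def)
  also have "\<dots> = transpose ((A ** Y) ** (A ** X))"
    using Y by (simp add: is_pinv_def matrix_mul_assoc)
  also have "\<dots> = A ** X ** (A ** Y)"
    using X Y by (simp only: is_pinv_def matrix_transpose_mul)
  also have "\<dots> = A ** Y"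
    using X by (simp add: is_pinv_def matrix_mul_assoc)
  finally have 1: "A ** X = A ** Y" .
  have "X ** A = transpose (X ** A)"
    using X by (simp add: is_pinv_def)
  also have "\<dots> = transpose ((X ** A) ** (Y ** A))"
    using Y by (metis is_pinv_def matrix_mul_assoc)
  also have "\<dots> = Y ** A ** (X ** A)"
    using X Y by (simp only: is_pinv_def matrix_transpose_mul)
  also have "\<dots> = Y ** A"
    using X by (metis is_pinv_def matrix_mul_assoc)
  finally have 2: "X ** A = Y ** A" .
  have "X = X ** A ** X"
    using X by (simp add: is_pinv_def)
  also have "\<dots> = Y ** (A ** X)"
    by (simp add: 2 matrix_mul_assoc)
  also have "\<dots> = Y"
    using Y by (simp add: 1 is_pinv_def matrix_mul_assoc)
  finally show ?thesis .
qed

lemma orthogonal_projection_exists: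
  fixes S :: "'a::euclidean_space set"
  assumes "subspace S"
  shows "\<exists>P. linear P \<and> (\<forall>x y. P x \<bullet> y = x \<bullet> P y) \<and> range P \<subseteq> S \<and> (\<forall>x\<in>S. P x = x)"
proof -
  obtain B where B: "B \<subseteq> S" "pairwise orthogonal B" "\<And>x. x \<in> B \<Longrightarrow> norm x = 1"
    "independent B" "span B = S"
    using orthonormal_basis_subspace[OF assms] by metis
  define P where "P = (\<lambda>x. \<Sum>b\<in>B. (b \<bullet> x) *\<^sub>R b)"
  have "linear P"
    by (rule linearI) (simp_all add: P_def inner_add_right scaleR_add_left sum.distrib scaleR_sum_right)
  moreover have "P x \<bullet> y = x \<bullet> P y" for x y
    by (simp add: P_def inner_sum_left inner_sum_right inner_commute mult.commute)
  moreover have PS: "P x \<in> S" for x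
    unfolding P_def using B by (intro subspace_sum[OF assms] subspace_scale[OF assms]) auto
  moreover have "P x = x" if "x \<in> S" for x
  proof -
    have "P x = (\<Sum>b\<in>B. (b \<bullet> x / (b \<bullet> b)) *\<^sub>R b)"
      unfolding P_def using B(3) by (intro sum.cong) (auto simp: dot_square_norm)
    then have *: "orthogonal y (x - P x)" if "y \<in> S" for y
      using Gram_Schmidt_step[OF B(2), of y x] B(5) that by simp
    have "x - P x \<in> S"
      using that PS by (intro subspace_diff[OF assms])
    from *[OF this] show ?thesis
      by (simp add: orthogonal_self)
  qed
  ultimately show ?thesis by blast
qed

lemma transpose_matrix_self_adjoint:
  fixes f :: "real ^ 'n \<Rightarrow> real ^ 'n"
  assumes "linear f" "\<And>x y. f x \<bullet> y = x \<bullet> f y"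
  shows "transpose (matrix f) = matrix f"
  using assms(2) by (metis adjoint_unique assms(1) matrix_adjoint)

lemma is_pinv_exists: "\<exists>X. is_pinv A X"
proof -
  define f where "f = (\<lambda>x. A *v x)"
  have f: "linear f" and mf: "matrix f = A"
    by (simp_all add: f_def matrix_vector_mul_linear)
  obtain P where P: "linear P" "\<And>x y. P x \<bullet> y = x \<bullet> P y" "range P \<subseteq> range f" "\<And>y. y \<in> range f \<Longrightarrow> P y = y"
    using orthogonal_projection_exists[OF linear_subspace_image[OF f subspace_UNIV]] by blast
  obtain Q where Q: "linear Q" "\<And>x y. Q x \<bullet> y = x \<bullet> Q y" "range Q \<subseteq> {x. f x = 0}"
    "\<And>x. f x = 0 \<Longrightarrow> Q x = x"
    using orthogonal_projection_exists[OF linear_subspace_kernel[OF f]] by blast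
  obtain h where h: "linear h" "\<And>y. y \<in> range f \<Longrightarrow> f (h y) = y"
    using linear_exists_right_inverse_on[OF f subspace_UNIV] by blast
  define R where "R = (\<lambda>x. x - Q x)"
  have R: "linear R" "\<And>x y. R x \<bullet> y = x \<bullet> R y"
    using Q(1,2) by (auto simp: R_def linear_compose_sub linear_ident inner_diff_left inner_diff_right)
  have fR: "f (R x) = f x" for x
    using Q(3) linear_diff[OF f] by (auto simp: R_def)
  have R0: "R x = 0" if "f x = 0" for x
    using Q(4)[OF that] by (simp add: R_def)
  have Rf: "R x = R y" if "f x = f y" for x y
    using R0[of "x - y"] that linear_diff[OF f] linear_diff[OF R(1)] by simp
  define g where "g = R \<circ> h \<circ> P"
  have g: "linear g"
    unfolding g_def using P(1) h(1) R(1) by (intro linear_compose)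
  have fg: "f (g y) = P y" for y
    using P(3) by (auto simp: g_def fR intro!: h(2))
  have gf: "g (f x) = R x" for x
    unfolding g_def o_def by (rule Rf) (simp add: P(4) h(2))
  have fgf: "f \<circ> g \<circ> f = f" and gfg: "g \<circ> f \<circ> g = g"
    using P(3) by (auto simp: fun_eq_iff fg P(4)) (simp add: g_def P(4) range_subsetD)
  have cg: "f \<circ> g = P" "g \<circ> f = R"
    by (auto simp: fun_eq_iff gf fg)
  have m: "matrix (f \<circ> g) = A ** matrix g" "matrix (g \<circ> f) = matrix g ** A"
    using matrix_compose[OF g f] matrix_compose[OF f g] mf by auto
  have "A ** matrix g ** A = A"
    using matrix_compose[OF f linear_compose[OF g f]] mf fgf m by (simp add: o_assoc)
  moreover have "matrix g ** A ** matrix g = matrix g"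
    using matrix_compose[OF g linear_compose[OF f g]] gfg m by (simp add: o_assoc)
  moreover have "transpose (A ** matrix g) = A ** matrix g"
    using transpose_matrix_self_adjoint[OF P(1,2)] m(1) cg(1) by simp
  moreover have "transpose (matrix g ** A) = matrix g ** A"
    using transpose_matrix_self_adjoint[OF R(1,2)] m(2) cg(2) by simp
  ultimately show ?thesis
    unfolding is_pinv_def by blast
qed

lemma is_pinv_pinv: "is_pinv A (pinv A)"
  unfolding pinv_def using is_pinv_exists is_pinv_unique by (metis theI)

lemma matrix_inv_both:
  assumes "invertible S"
  shows "S ** matrix_inv S = mat 1" "matrix_inv S ** S = mat 1"
  using someI_ex[OF assms[unfolded invertible_def]] by (simp_all add: matrix_inv_def)

lemma pinv_invertible:
  fixes S :: "real ^ 'n ^ 'n"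
  assumes "invertible S"
  shows "pinv S = matrix_inv S"
proof (rule is_pinv_unique[OF is_pinv_pinv])
  show "is_pinv S (matrix_inv S)"
    by (simp add: is_pinv_def matrix_inv_both[OF assms] transpose_mat)
qed

lemma confidence_ellipsoid_invertible:
  fixes S :: "real ^ 'n::finite ^ 'n"
  assumes "invertible S"
  shows "confidence_ellipsoid m S \<alpha> =
    {a. (a - m) \<bullet> (matrix_inv S *v (a - m)) \<le> sqrt (chi_squared_quantile CARD('n) \<alpha>)}"
proof -
  have "x = S *v (matrix_inv S *v x)" for x
    by (simp add: matrix_vector_mul_assoc matrix_inv_both(1)[OF assms])
  then have "range ((*v) S) = UNIV"
    by blast
  then show ?thesis
    by (simp add: confidence_ellipsoid_def pinv_invertible[OF assms])
qed

end

theory Submission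
  imports Defs
begin

text \<open>
  Both estimators are images of sample means under the same affine map \<open>c \<mapsto> C c + k\<close>.  Averaging
  divides a covariance by the number of samples, and \<open>p\<close> is invariant under complements, so with
  \<open>X = Z v(Z)\<close> and \<open>Y = (\<one> - Z) v(\<one> - Z)\<close> we have \<open>Cov(Y) = Cov(X)\<close> and \<open>Cov(Y, X) = Cov(X, Y)\<close>;
  pairing therefore changes \<open>Cov(X) / 2n\<close> into \<open>(Cov(X) + Cov(X, Y)) / 2n\<close>.  If \<open>G\<^sub>v\<close> is positive
  semi-definite, the second covariance is smaller in the Loewner order for every \<open>n \<ge> 1\<close>, and the
  ellipsoids are monotone in that order.
\<close>

section \<open>Bilinear forms of matrices\<close>

text \<open>Reduces identities between covariance matrices to scalar identities between real
  expectations, tested against fixed vectors \<open>a\<close> and \<open>b\<close>.\<close>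

lemma matrix_eqI_inner:
  fixes A B :: "real ^ 'n ^ 'm"
  assumes "\<And>a b. a \<bullet> (A *v b) = a \<bullet> (B *v b)"
  shows "A = B"
proof -
  have "A *v b = B *v b" for b
    using assms vector_eq_ldot by blast
  then show ?thesis
    by (simp add: matrix_eq)
qed

text \<open>The simp rule \<open>transpose_matrix_vector\<close> would rewrite
  \<open>transpose A *v a\<close> to \<open>a v* A\<close>; later simp calls delete it to keep this
  form.\<close>

lemma inner_matrix_transpose:
  fixes A :: "real ^ 'n ^ 'm"
  shows "a \<bullet> (A *v b) = (transpose A *v a) \<bullet> b"
  by (simp add: dot_lmul_matrix)

lemma inner_outer_mult: "a \<bullet> (outer x y *v b) = (a \<bullet> x) * (b \<bullet> y)"
proof -
  have "a \<bullet> (outer x y *v b) = (\<Sum>i\<in>UNIV. \<Sum>j\<in>UNIV. (a $ i * x $ i) * (b $ j * y $ j))"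
    by (simp add: inner_vec_def matrix_vector_mult_def outer_def sum_distrib_left algebra_simps)
  also have "\<dots> = (a \<bullet> x) * (b \<bullet> y)"
    by (simp add: inner_vec_def sum_product)
  finally show ?thesis .
qed

lemma scaleR_matrix_vector_mult:
  fixes A :: "real ^ 'n ^ 'm"
  shows "(c *\<^sub>R A) *v x = c *\<^sub>R (A *v x)"
  by (simp add: scaleR_matrix_vector_assoc)

text \<open>Lets the form be moved inside a matrix-valued integral; in finite dimension linearity
  already gives boundedness.\<close>

lemma bounded_linear_inner_mult:
  fixes a :: "real ^ 'm" and b :: "real ^ 'n"
  shows "bounded_linear (\<lambda>A :: real ^ 'n ^ 'm. a \<bullet> (A *v b))"
  by (intro linear_conv_bounded_linear[THEN iffD1] linearI)
    (simp_all add: matrix_vector_mult_add_rdistrib scaleR_matrix_vector_mult inner_add_right)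

lemma psd_conjugate:
  fixes C G :: "real ^ 'n::finite ^ 'n"
  assumes "psd G" "0 \<le> c"
  shows "psd (c *\<^sub>R (C ** G ** transpose C))"
proof -
  have "transpose (C ** G ** transpose C) = C ** G ** transpose C"
    using assms(1) by (simp add: psd_def matrix_transpose_mul matrix_mul_assoc)
  moreover have "x \<bullet> ((C ** G ** transpose C) *v x)
      = (transpose C *v x) \<bullet> (G *v (transpose C *v x))" for x
    using inner_matrix_transpose[of x C "G *v (transpose C *v x)"]
    by (simp add: matrix_vector_mul_assoc [symmetric] del: transpose_matrix_vector)
  ultimately show ?thesis
    using assms by (auto simp: psd_def scaleR_matrix_vector_mult transpose_scalar
        intro!: mult_nonneg_nonneg simp del: transpose_matrix_vector)
qed

section \<open>Monotonicity of the ellipsoids\<close>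

text \<open>\<open>S ** pinv S\<close> is the orthogonal projection onto the range of
  \<open>S\<close>, so the claim is that the range of \<open>T\<close> lies in that of
  \<open>S\<close>. The residual \<open>e\<close> of \<open>y\<close> lies in the kernel of
  \<open>S\<close>. As \<open>T\<close> lies between 0 and \<open>S\<close>, its form vanishes at
  \<open>e\<close>, so \<open>e\<close> is orthogonal to the range of \<open>T\<close>, which
  contains \<open>y\<close>.\<close>

lemma mult_pinv_mult_psd_le:
  fixes S T :: "real ^ 'n::finite ^ 'n"
  assumes T: "psd T" and ST: "psd (S - T)" and y: "y \<in> range ((*v) T)"
  shows "S *v (pinv S *v y) = y"
proof -
  obtain u where u: "y = T *v u"
    using y by blast
  have sT: "transpose T = T" and sST: "transpose (S - T) = S - T"
    using T ST by (auto simp: psd_def)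
  have sS: "transpose S = S"
    using sT sST by (simp add: transpose_def vec_eq_iff)
  define P where "P = S ** pinv S"
  have P: "transpose P = P" "P ** S = S"
    using is_pinv_pinv[of S] by (auto simp: P_def is_pinv_def)
  have SP: "S ** P = S"
    using arg_cong[OF P(2), of transpose] by (simp add: matrix_transpose_mul P(1) sS)
  define e where "e = y - P *v y"
  have Se: "S *v e = 0"
    by (simp add: e_def matrix_vector_mult_diff_distrib matrix_vector_mul_assoc SP)
  have eP: "e \<bullet> (P *v y) = 0"
    using inner_matrix_transpose[of e S "pinv S *v y"]
    by (simp add: P_def matrix_vector_mul_assoc [symmetric] sS Se del: transpose_matrix_vector)
  have "0 \<le> e \<bullet> ((S - T) *v e)" "0 \<le> e \<bullet> (T *v e)"
    using T ST by (auto simp: psd_def)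
  then have eTe: "e \<bullet> (T *v e) = 0"
    by (simp add: matrix_vector_mult_diff_rdistrib Se)
  have uTe: "u \<bullet> (T *v e) = e \<bullet> y"
    using inner_matrix_transpose[of u T e]
    by (simp add: sT u inner_commute del: transpose_matrix_vector)
  \<comment> \<open>The quadratic term in \<open>t\<close> vanishes because
    \<open>e \<bullet> (T *v e) = 0\<close>; an affine function of \<open>t\<close> that is bounded
    below has slope zero.\<close>
  have line: "0 \<le> u \<bullet> y - 2 * t * (e \<bullet> y)" for t
  proof -
    have "0 \<le> (u - t *\<^sub>R e) \<bullet> (T *v (u - t *\<^sub>R e))"
      using T by (auto simp: psd_def)
    also have "\<dots> = u \<bullet> y - 2 * t * (e \<bullet> y)"
      by (simp add: matrix_vector_mult_diff_distrib matrix_vector_mult_scaleR inner_diff_left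
          inner_diff_right eTe uTe flip: u)
    finally show ?thesis .
  qed
  have "e \<bullet> y = 0"
  proof (rule ccontr)
    assume "e \<bullet> y \<noteq> 0"
    then show False
      \<comment> \<open>This \<open>t\<close> makes the right-hand side of \<open>line\<close> equal
        to -1.\<close>
      using line[of "(u \<bullet> y + 1) / (2 * (e \<bullet> y))"] by (simp add: field_simps)
  qed
  moreover have "e \<bullet> e = e \<bullet> y - e \<bullet> (P *v y)"
    by (simp add: e_def inner_diff_right)
  ultimately have "e = 0"
    using eP by simp
  then show ?thesis
    by (simp add: e_def P_def matrix_vector_mul_assoc)
qed

text \<open>On the range of \<open>T\<close>, pseudo-inversion reverses the Loewner order. With
  \<open>S *v w = y = T *v u\<close>, expanding the form of \<open>T\<close> at \<open>w - u\<close>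
  and bounding \<open>w \<bullet> (T *v w)\<close> by \<open>w \<bullet> y\<close> gives
  \<open>w \<bullet> y \<le> u \<bullet> y\<close>.\<close>

lemma confidence_ellipsoid_mono:
  fixes S T :: "real ^ 'n::finite ^ 'n"
  assumes T: "psd T" and ST: "psd (S - T)"
  shows "confidence_ellipsoid m T \<alpha> \<subseteq> confidence_ellipsoid m S \<alpha>"
proof
  fix a assume a: "a \<in> confidence_ellipsoid m T \<alpha>"
  define y where "y = a - m"
  have y: "y \<in> range ((*v) T)"
    and le: "y \<bullet> (pinv T *v y) \<le> sqrt (chi_squared_quantile CARD('n) \<alpha>)"
    using a by (auto simp: confidence_ellipsoid_def y_def)
  define w where "w = pinv S *v y"
  define u where "u = pinv T *v y"
  have Sw: "S *v w = y"
    unfolding w_def by (rule mult_pinv_mult_psd_le[OF T ST y])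
  \<comment> \<open>The range lemma is reused with \<open>S = T\<close>, where the difference is the
    zero matrix.\<close>
  have "psd (T - T)"
    by (simp add: psd_def transpose_def vec_eq_iff)
  from mult_pinv_mult_psd_le[OF T this y] have Tu: "T *v u = y"
    unfolding u_def .
  have "transpose T = T"
    using T by (simp add: psd_def)
  then have uTw: "u \<bullet> (T *v w) = w \<bullet> y"
    using inner_matrix_transpose[of u T w] Tu
    by (simp add: inner_commute del: transpose_matrix_vector)
  have "w \<bullet> (T *v w) \<le> w \<bullet> y"
    using ST by (auto simp: psd_def matrix_vector_mult_diff_rdistrib inner_diff_right
        simp flip: Sw)
  moreover have "0 \<le> (w - u) \<bullet> (T *v (w - u))"
    using T by (auto simp: psd_def)
  then have "0 \<le> w \<bullet> (T *v w) - 2 * (w \<bullet> y) + u \<bullet> y"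
    by (simp add: matrix_vector_mult_diff_distrib inner_diff_left inner_diff_right uTw Tu)
  ultimately have "y \<bullet> w \<le> y \<bullet> u"
    by (simp add: inner_commute)
  with le have "y \<bullet> (pinv S *v y) \<le> sqrt (chi_squared_quantile CARD('n) \<alpha>)"
    by (simp add: w_def u_def)
  moreover have "y \<in> range ((*v) S)"
    using Sw by blast
  ultimately show "a \<in> confidence_ellipsoid m S \<alpha>"
    by (simp add: confidence_ellipsoid_def y_def)
qed

section \<open>Covariance matrices\<close>

lemma inner_Cov:
  assumes "integrable M X" "integrable M Y" "integrable M (\<lambda>\<omega>. outer (X \<omega>) (Y \<omega>))"
  shows "a \<bullet> (Cov M X Y *v b)
    = (\<integral>\<omega>. (a \<bullet> X \<omega>) * (b \<bullet> Y \<omega>) \<partial>M) - (\<integral>\<omega>. a \<bullet> X \<omega> \<partial>M) * (\<integral>\<omega>. b \<bullet> Y \<omega> \<partial>M)"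
  using integral_bounded_linear[OF bounded_linear_inner_mult assms(3), of a b] assms(1,2)
  by (simp add: Cov_def matrix_vector_mult_diff_rdistrib inner_diff_right inner_outer_mult)

text \<open>The samples take finitely many values, so every random vector built from finitely many
  of them is simple, and integrability needs no moment assumptions.\<close>

lemma (in finite_measure) integrable_simple:
  fixes f :: "'a \<Rightarrow> 'b::{banach, second_countable_topology}"
  assumes "simple_function M f"
  shows "integrable M f"
  using assms by (rule integrable_simple_function) simp

lemma (in finite_measure) inner_Cov_simple:
  assumes "simple_function M X" "simple_function M Y"
  shows "a \<bullet> (Cov M X Y *v b)
    = (\<integral>\<omega>. (a \<bullet> X \<omega>) * (b \<bullet> Y \<omega>) \<partial>M) - (\<integral>\<omega>. a \<bullet> X \<omega> \<partial>M) * (\<integral>\<omega>. b \<bullet> Y \<omega> \<partial>M)"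
  by (intro inner_Cov integrable_simple assms simple_function_compose2[OF assms])

text \<open>The quadratic form of the covariance at \<open>x\<close> is the variance of
  \<open>x \<bullet> X\<close>.\<close>

lemma (in prob_space) psd_Cov_simple:
  assumes X: "simple_function M X"
  shows "psd (Cov M X X)"
proof -
  have "a \<bullet> (Cov M X X *v b) = b \<bullet> (Cov M X X *v a)" for a b
    by (simp only: inner_Cov_simple[OF X X] mult.commute)
  then have "transpose (Cov M X X) = Cov M X X"
    by (intro matrix_eqI_inner)
      (metis inner_matrix_transpose transpose_transpose inner_commute)
  moreover have "0 \<le> x \<bullet> (Cov M X X *v x)" for x
  proof -
    have "simple_function M (\<lambda>\<omega>. x \<bullet> X \<omega>)" "simple_function M (\<lambda>\<omega>. (x \<bullet> X \<omega>)\<^sup>2)"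
      by (rule simple_function_compose1[OF X])+
    then have "variance (\<lambda>\<omega>. x \<bullet> X \<omega>) = x \<bullet> (Cov M X X *v x)"
      by (subst variance_eq) (auto simp: inner_Cov_simple[OF X X] power2_eq_square intro: integrable_simple)
    then show ?thesis
      using variance_positive[of "\<lambda>\<omega>. x \<bullet> X \<omega>"] by simp
  qed
  ultimately show ?thesis
    by (simp add: psd_def)
qed

text \<open>Deterministic shifts drop out of a covariance, and \<open>C\<close> moves onto the test
  vectors as \<open>transpose C\<close>.\<close>

lemma (in prob_space) Cov_affine_simple:
  fixes C :: "real ^ 'n::finite ^ 'n"
  assumes X: "simple_function M X"
  shows "Cov M (\<lambda>\<omega>. k + C *v X \<omega>) (\<lambda>\<omega>. k + C *v X \<omega>) = C ** Cov M X X ** transpose C"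
proof (rule matrix_eqI_inner)
  fix a b
  define a' where "a' = transpose C *v a"
  define b' where "b' = transpose C *v b"
  have int: "integrable M (\<lambda>\<omega>. h (X \<omega>))" for h :: "_ \<Rightarrow> real"
    by (intro integrable_simple simple_function_compose1[OF X])
  have inner: "a \<bullet> (k + C *v x) = a \<bullet> k + a' \<bullet> x" "b \<bullet> (k + C *v x) = b \<bullet> k + b' \<bullet> x" for x
    by (simp_all add: a'_def b'_def inner_add_right inner_matrix_transpose
        del: transpose_matrix_vector)
  have CX: "simple_function M (\<lambda>\<omega>. k + C *v X \<omega>)"
    by (rule simple_function_compose1[OF X])
  have "a \<bullet> (Cov M (\<lambda>\<omega>. k + C *v X \<omega>) (\<lambda>\<omega>. k + C *v X \<omega>) *v b)
      = (\<integral>\<omega>. (a' \<bullet> X \<omega>) * (b' \<bullet> X \<omega>) \<partial>M) - (\<integral>\<omega>. a' \<bullet> X \<omega> \<partial>M) * (\<integral>\<omega>. b' \<bullet> X \<omega> \<partial>M)"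
    using int[of "\<lambda>x. a' \<bullet> x"] int[of "\<lambda>x. b' \<bullet> x"] int[of "\<lambda>x. (a' \<bullet> x) * (b' \<bullet> x)"]
    unfolding inner_Cov_simple[OF CX CX] inner by (simp add: prob_space algebra_simps)
  also have "\<dots> = a \<bullet> ((C ** Cov M X X ** transpose C) *v b)"
    by (simp add: inner_Cov_simple[OF X X, symmetric] inner_matrix_transpose[of a C]
        a'_def b'_def matrix_vector_mul_assoc [symmetric] del: transpose_matrix_vector)
  finally show "a \<bullet> (Cov M (\<lambda>\<omega>. k + C *v X \<omega>) (\<lambda>\<omega>. k + C *v X \<omega>) *v b)
      = a \<bullet> ((C ** Cov M X X ** transpose C) *v b)" .
qed

section \<open>Independent samples from a law on a finite type\<close>

lemma integrable_pmf_finite_type: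
  fixes f :: "'s::finite \<Rightarrow> 'b::{banach, second_countable_topology}"
  shows "integrable (measure_pmf p) f"
  by (intro integrable_measure_pmf_finite) simp

lemma simple_function_pmf_finite_type: "simple_function (measure_pmf p) (f :: 's::finite \<Rightarrow> 'b)"
  by (simp add: simple_function_def)

text \<open>The law \<open>p\<close> is kept arbitrary, since averaging uses nothing about the
  Shapley kernel; the two estimators differ only in the function averaged, the sample size and a
  constant.\<close>

locale iid_sample = prob_space M for M :: "'a measure" +
  fixes z :: "nat \<Rightarrow> 'a \<Rightarrow> 's::finite" and p :: "'s pmf"
  assumes indep: "indep_vars (\<lambda>_. count_space UNIV) z {1..}"
    and law: "\<And>i. i \<ge> 1 \<Longrightarrow> distr M (count_space UNIV) (z i) = measure_pmf p"
begin

lemma measurable_sample: "i \<ge> 1 \<Longrightarrow> z i \<in> measurable M (count_space UNIV)"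
  using indep by (auto simp: indep_vars_def)

lemma simple_sample: "i \<ge> 1 \<Longrightarrow> simple_function M (\<lambda>\<omega>. F (z i \<omega>))"
  by (rule simple_function_compose1[where f = "z i"])
    (use measurable_sample in \<open>auto simp: simple_function_def\<close>)

lemma expectation_sample:
  fixes h :: "'s \<Rightarrow> real"
  assumes "i \<ge> 1"
  shows "expectation (\<lambda>\<omega>. h (z i \<omega>)) = measure_pmf.expectation p h"
  using integral_distr[OF measurable_sample[OF assms], of h] law[OF assms] by simp

lemma expectation_sample_mult:
  fixes f g :: "'s \<Rightarrow> real"
  assumes "i \<ge> 1" "j \<ge> 1" "i \<noteq> j"
  shows "expectation (\<lambda>\<omega>. f (z i \<omega>) * g (z j \<omega>))
    = measure_pmf.expectation p f * measure_pmf.expectation p g"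
proof -
  \<comment> \<open>A single family carrying \<open>f\<close> at index \<open>i\<close> and
    \<open>g\<close> at index \<open>j\<close>, so that the product rule for independent variables
    applies.\<close>
  define h where "h = (\<lambda>k. if k = i then f else g)"
  have ij: "{i, j} \<subseteq> {1..}"
    using assms by auto
  have "indep_vars (\<lambda>_. borel) (\<lambda>k \<omega>. h k (z k \<omega>)) {i, j}"
    by (rule indep_vars_compose2[OF indep_vars_subset[OF indep ij]]) simp
  then have "expectation (\<lambda>\<omega>. \<Prod>k\<in>{i, j}. h k (z k \<omega>))
      = (\<Prod>k\<in>{i, j}. expectation (\<lambda>\<omega>. h k (z k \<omega>)))"
    using ij by (intro indep_vars_lebesgue_integral integrable_simple simple_sample) auto
  then show ?thesis
    using assms by (simp add: h_def expectation_sample)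
qed

lemma simple_sample_mean:
  fixes F :: "'s \<Rightarrow> real ^ 'n::finite"
  shows "simple_function M (\<lambda>\<omega>. (1 / real N) *\<^sub>R (\<Sum>i=1..N. F (z i \<omega>)))"
  by (rule simple_function_compose1[where g = "\<lambda>x. (1 / real N) *\<^sub>R x"])
    (intro simple_function_sum simple_sample, simp)

lemma Cov_sample_mean:
  fixes F :: "'s \<Rightarrow> real ^ 'n::finite"
  assumes N: "N \<ge> 1"
  defines "X \<equiv> \<lambda>\<omega>. (1 / real N) *\<^sub>R (\<Sum>i=1..N. F (z i \<omega>))"
  shows "Cov M X X = (1 / real N) *\<^sub>R Cov (measure_pmf p) F F"
proof (rule matrix_eqI_inner)
  fix a b
  define f where "f = (\<lambda>s. a \<bullet> F s)"
  define g where "g = (\<lambda>s. b \<bullet> F s)"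
  define Ef where "Ef = measure_pmf.expectation p f"
  define Eg where "Eg = measure_pmf.expectation p g"
  define Efg where "Efg = measure_pmf.expectation p (\<lambda>s. f s * g s)"
  have X: "simple_function M X"
    unfolding X_def by (rule simple_sample_mean)
  have aX: "a \<bullet> X \<omega> = (\<Sum>i=1..N. f (z i \<omega>)) / N" and bX: "b \<bullet> X \<omega> = (\<Sum>i=1..N. g (z i \<omega>)) / N" for \<omega>
    by (simp_all add: X_def f_def g_def inner_sum_right)
  have mean: "expectation (\<lambda>\<omega>. (\<Sum>i=1..N. h (z i \<omega>)) / N) = measure_pmf.expectation p h"
    for h :: "'s \<Rightarrow> real"
    using N by (simp add: Bochner_Integration.integral_sum integrable_simple simple_sample
        expectation_sample)
  have int: "integrable M (\<lambda>\<omega>. f (z i \<omega>) * g (z j \<omega>))" if "i \<ge> 1" "j \<ge> 1" for i j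
    using that by (intro integrable_simple simple_function_mult simple_sample)
  have "expectation (\<lambda>\<omega>. (\<Sum>i=1..N. f (z i \<omega>)) * (\<Sum>i=1..N. g (z i \<omega>)))
      = (\<Sum>i=1..N. \<Sum>j=1..N. expectation (\<lambda>\<omega>. f (z i \<omega>) * g (z j \<omega>)))"
    unfolding sum_product
    by (subst Bochner_Integration.integral_sum, intro Bochner_Integration.integrable_sum int, simp, simp)
      (intro sum.cong refl Bochner_Integration.integral_sum int, simp_all)
  \<comment> \<open>Independence gives \<open>Ef * Eg\<close> off the diagonal; each of the
    \<open>N\<close> diagonal terms adds a correction. After division by the square of
    \<open>N\<close>, the product of the means cancels and one factor \<open>1 / N\<close>
    remains.\<close>
  also have "\<dots> = (\<Sum>i=1..N. \<Sum>j=1..N. Ef * Eg + (if i = j then Efg - Ef * Eg else 0))"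
    unfolding Ef_def Eg_def Efg_def
    by (intro sum.cong refl)
      (auto simp: expectation_sample_mult expectation_sample[of _ "\<lambda>s. f s * g s"])
  also have "\<dots> = real N * real N * (Ef * Eg) + real N * (Efg - Ef * Eg)"
    by (simp add: sum.distrib algebra_simps)
  finally have "expectation (\<lambda>\<omega>. (a \<bullet> X \<omega>) * (b \<bullet> X \<omega>))
      = Ef * Eg + (Efg - Ef * Eg) / real N"
    using N by (simp add: aX bX add_divide_distrib)
  moreover have "expectation (\<lambda>\<omega>. a \<bullet> X \<omega>) = Ef" "expectation (\<lambda>\<omega>. b \<bullet> X \<omega>) = Eg"
    unfolding aX bX mean Ef_def Eg_def by simp_all
  ultimately have "a \<bullet> (Cov M X X *v b) = (1 / real N) * (Efg - Ef * Eg)"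
    by (simp add: inner_Cov_simple[OF X X])
  also have "\<dots> = a \<bullet> (((1 / real N) *\<^sub>R Cov (measure_pmf p) F F) *v b)"
    by (simp add: scaleR_matrix_vector_mult measure_pmf.inner_Cov_simple
        simple_function_pmf_finite_type Ef_def Eg_def Efg_def f_def g_def)
  finally show "a \<bullet> (Cov M X X *v b) = a \<bullet> (((1 / real N) *\<^sub>R Cov (measure_pmf p) F F) *v b)" .
qed

end

section \<open>The Shapley kernel and the two estimators\<close>

text \<open>Both the binomial coefficient and the product k(d-k) are symmetric under exchanging k
  and d-k.\<close>

lemma shapley_weight_Compl: "shapley_weight (- S) = shapley_weight (S :: 'n::finite set)"
proof -
  have le: "card S \<le> CARD('n)"
    by (simp add: card_mono)
  moreover have "card (- S) = CARD('n) - card S"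
    by (simp add: Compl_eq_Diff_UNIV card_Diff_subset)
  ultimately show ?thesis
    using binomial_symmetric[OF le]
    by (auto simp: shapley_weight_def Let_def of_nat_diff mult_ac)
qed

text \<open>Complementation permutes the coalitions and preserves their weights, so the finite sum
  can be reindexed.\<close>

lemma expectation_shapley_kernel_Compl:
  fixes h :: "'n::finite set \<Rightarrow> real"
  assumes "CARD('n) \<ge> 2"
  shows "measure_pmf.expectation shapley_kernel (\<lambda>S. h (- S))
    = measure_pmf.expectation shapley_kernel h"
proof -
  have "(\<Sum>S\<in>UNIV. pmf shapley_kernel S *\<^sub>R h (- S)) = (\<Sum>S\<in>UNIV. pmf shapley_kernel S *\<^sub>R h S)"
    by (rule sum.reindex_bij_witness[of _ uminus uminus])
      (simp_all add: pmf_shapley_kernel[OF assms] shapley_weight_Compl)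
  then show ?thesis
    by (subst (1 2) integral_measure_pmf[of UNIV]) auto
qed

text \<open>Expanding gives a quarter of two variance and two cross terms. By complement invariance
  the terms agree in pairs, and \<open>G_mat\<close> is minus the cross term.\<close>

lemma Cov_shapley_kernel_average:
  fixes v :: "'n::finite set \<Rightarrow> real"
  assumes "CARD('n) \<ge> 2"
  defines "X \<equiv> \<lambda>S. v S *\<^sub>R bits S" and "Y \<equiv> \<lambda>S. v (- S) *\<^sub>R bits (- S)"
  shows "Cov (measure_pmf shapley_kernel) (\<lambda>S. (1 / 2) *\<^sub>R (X S + Y S)) (\<lambda>S. (1 / 2) *\<^sub>R (X S + Y S))
    = (1 / 2) *\<^sub>R (Cov (measure_pmf shapley_kernel) X X - G_mat v)"
proof (rule matrix_eqI_inner)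
  fix a b
  note E = expectation_shapley_kernel_Compl[OF assms(1)]
  have "measure_pmf.expectation shapley_kernel (\<lambda>S. a \<bullet> Y S)
      = measure_pmf.expectation shapley_kernel (\<lambda>S. a \<bullet> X S)" for a
    using E[of "\<lambda>S. a \<bullet> X S"] by (simp add: X_def Y_def)
  moreover have "measure_pmf.expectation shapley_kernel (\<lambda>S. (a \<bullet> Y S) * (b \<bullet> Y S))
      = measure_pmf.expectation shapley_kernel (\<lambda>S. (a \<bullet> X S) * (b \<bullet> X S))"
    using E[of "\<lambda>S. (a \<bullet> X S) * (b \<bullet> X S)"] by (simp add: X_def Y_def)
  moreover have "measure_pmf.expectation shapley_kernel (\<lambda>S. (a \<bullet> Y S) * (b \<bullet> X S))
      = measure_pmf.expectation shapley_kernel (\<lambda>S. (a \<bullet> X S) * (b \<bullet> Y S))"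
    using E[of "\<lambda>S. (a \<bullet> X S) * (b \<bullet> Y S)"] by (simp add: X_def Y_def)
  moreover have "G_mat v = - Cov (measure_pmf shapley_kernel) X Y"
    by (simp add: G_mat_def X_def Y_def)
  ultimately show "a \<bullet> (Cov (measure_pmf shapley_kernel) (\<lambda>S. (1 / 2) *\<^sub>R (X S + Y S))
          (\<lambda>S. (1 / 2) *\<^sub>R (X S + Y S)) *v b)
      = a \<bullet> (((1 / 2) *\<^sub>R (Cov (measure_pmf shapley_kernel) X X - G_mat v)) *v b)"
    by (simp add: scaleR_matrix_vector_mult measure_pmf.inner_Cov_simple
        simple_function_pmf_finite_type matrix_vector_mult_add_rdistrib inner_add_right
        integrable_pmf_finite_type distrib_left distrib_right add_divide_distrib)
qed

text \<open>For singular \<open>A\<close> the junk values of \<open>matrix_inv\<close> and of division by 0 agree on both sides.\<close>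

lemma solution_of_affine:
  fixes v :: "'n::finite set \<Rightarrow> real"
  obtains k where "\<And>c. solution_of v c = k + C_mat *v c"
proof
  fix c :: "real ^ 'n"
  define A1 where "A1 = matrix_inv (A_mat :: real ^ 'n ^ 'n)"
  define s where "s = (1 :: real ^ 'n) \<bullet> (A1 *v 1)"
  have "outer 1 1 *v x = (1 \<bullet> x) *\<^sub>R (1 :: real ^ 'n)" for x :: "real ^ 'n"
    by (simp add: outer_def matrix_vector_mult_def inner_vec_def vec_eq_iff)
  then have "C_mat *v c = A1 *v c - ((1 \<bullet> (A1 *v c)) / s) *\<^sub>R (A1 *v 1)"
    by (simp add: C_mat_def Let_def A1_def s_def matrix_vector_mult_diff_rdistrib
        scaleR_matrix_vector_mult matrix_vector_mul_assoc [symmetric] matrix_vector_mult_scaleR)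
  moreover have "solution_of v c
      = A1 *v c - ((1 \<bullet> (A1 *v c) - v UNIV + v {}) / s) *\<^sub>R (A1 *v 1)"
    by (simp add: solution_of_def Let_def A1_def s_def matrix_vector_mult_diff_distrib
        matrix_vector_mult_scaleR)
  \<comment> \<open>This equation fixes the witness \<open>k\<close>: it is the value of
    \<open>solution_of v\<close> at 0.\<close>
  ultimately show "solution_of v c = ((v UNIV - v {}) / ((1 :: real ^ 'n) \<bullet> (matrix_inv A_mat *v 1)))
      *\<^sub>R (matrix_inv A_mat *v 1) + C_mat *v c"
    by (simp add: A1_def s_def diff_divide_distrib add_divide_distrib scaleR_diff_left
        scaleR_add_left)
qed

text \<open>Common template for both estimators: the deterministic shift \<open>c\<close> is
  absorbed into the constant of the affine map, so only \<open>F\<close> and \<open>N\<close> affect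
  the covariance.\<close>

lemma (in iid_sample) Cov_solution_of_sample_mean:
  fixes F :: "'s \<Rightarrow> real ^ 'n::finite" and v :: "'n set \<Rightarrow> real"
  assumes N: "N \<ge> 1"
    and \<beta>: "\<And>\<omega>. \<beta> \<omega> = solution_of v ((1 / real N) *\<^sub>R (\<Sum>i=1..N. F (z i \<omega>)) - c)"
  shows "Cov M \<beta> \<beta> = (1 / real N) *\<^sub>R (C_mat ** Cov (measure_pmf p) F F ** transpose C_mat)"
    and "psd (Cov M \<beta> \<beta>)"
proof -
  obtain k where k: "\<And>c. solution_of v c = k + C_mat *v c"
    using solution_of_affine by blast
  define X where "X = (\<lambda>\<omega>. (1 / real N) *\<^sub>R (\<Sum>i=1..N. F (z i \<omega>)))"
  have X: "simple_function M X"
    unfolding X_def by (rule simple_sample_mean)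
  have \<beta>': "\<beta> = (\<lambda>\<omega>. (k - C_mat *v c) + C_mat *v X \<omega>)"
    by (auto simp: fun_eq_iff \<beta> k X_def matrix_vector_mult_diff_distrib)
  show "psd (Cov M \<beta> \<beta>)"
    unfolding \<beta>' by (intro psd_Cov_simple simple_function_compose1[OF X])
  have "Cov M X X = (1 / real N) *\<^sub>R Cov (measure_pmf p) F F"
    unfolding X_def by (rule Cov_sample_mean[OF N])
  then show "Cov M \<beta> \<beta> = (1 / real N) *\<^sub>R (C_mat ** Cov (measure_pmf p) F F ** transpose C_mat)"
    unfolding \<beta>' Cov_affine_simple[OF X]
    by (simp add: matrix_scalar_ac scalar_matrix_assoc)
qed

theorem theorem1:
  fixes M :: "'a measure"
    and v :: "'n::finite set \<Rightarrow> real"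
    and z :: "nat \<Rightarrow> 'a \<Rightarrow> 'n set"
  assumes d: "CARD('n) \<ge> 2"
    and M: "prob_space M"
    and indep: "prob_space.indep_vars M (\<lambda>_. count_space UNIV) z {1..}"
    and law: "\<And>i. i \<ge> 1 \<Longrightarrow> distr M (count_space UNIV) (z i) = measure_pmf shapley_kernel"
  shows "(\<forall>n\<ge>1.
            Cov M (beta_unbiased v z (2 * n)) (beta_unbiased v z (2 * n))
            - Cov M (beta_paired v z n) (beta_paired v z n)
            = (1 / (2 * real n)) *\<^sub>R (C_mat ** G_mat v ** transpose C_mat))
       \<and> (\<forall>\<^sub>F n in sequentially. psd (G_mat v) \<longrightarrow>
            (\<forall>\<alpha>\<in>{0<..<1}.
               confidence_ellipsoid (beta_star v)
                 (Cov M (beta_paired v z n) (beta_paired v z n)) \<alpha>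
               \<subseteq> confidence_ellipsoid (beta_star v)
                 (Cov M (beta_unbiased v z (2 * n)) (beta_unbiased v z (2 * n))) \<alpha>))"
proof -
  interpret iid_sample M z shapley_kernel
    using M indep law by (simp add: iid_sample_def iid_sample_axioms_def)
  define X where "X = (\<lambda>S. v S *\<^sub>R bits S)"
  define Y where "Y = (\<lambda>S. v (- S) *\<^sub>R bits (- S))"
  define V where "V = Cov (measure_pmf shapley_kernel) X X"
  let ?U = "\<lambda>n. Cov M (beta_unbiased v z (2 * n)) (beta_unbiased v z (2 * n))"
  let ?P = "\<lambda>n. Cov M (beta_paired v z n) (beta_paired v z n)"
  have unbiased: "?U n = (1 / (2 * real n)) *\<^sub>R (C_mat ** V ** transpose C_mat)" if "n \<ge> 1" for n
    unfolding V_def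
    using Cov_solution_of_sample_mean(1)[of "2 * n" "beta_unbiased v z (2 * n)" v X
        "v {} *\<^sub>R measure_pmf.expectation shapley_kernel bits"] that
    by (simp add: beta_unbiased_def b_unbiased_def X_def)
  \<comment> \<open>The factor 1/(2n) splits as 1/n times 1/2, making each pair one draw of
    \<open>(X + Y) / 2\<close>. The \<open>n\<close> equal terms \<open>v {} *\<^sub>R 1\<close>
    average to the constant shift, which needs \<open>n\<close> nonzero.\<close>
  have half: "b_paired v z n \<omega>
      = (1 / real n) *\<^sub>R (\<Sum>i=1..n. (1 / 2) *\<^sub>R (X (z i \<omega>) + Y (z i \<omega>))) - (v {} / 2) *\<^sub>R 1"
    if "n \<ge> 1" for n \<omega>
    using that
    by (simp add: b_paired_def X_def Y_def sum_subtractf scaleR_diff_right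
        sum_constant_scaleR scaleR_sum_right [symmetric] del: sum_constant flip: scaleR_add_right)
  have paired: "?P n = (1 / real n) *\<^sub>R
        (C_mat ** ((1 / 2) *\<^sub>R (V - G_mat v)) ** transpose C_mat)"
    and psd: "psd (?P n)" if "n \<ge> 1" for n
    using Cov_solution_of_sample_mean[OF that, of "beta_paired v z n" v
        "\<lambda>S. (1 / 2) *\<^sub>R (X S + Y S)" "(v {} / 2) *\<^sub>R 1"]
      Cov_shapley_kernel_average[OF d, of v] half[OF that]
    by (simp_all add: beta_paired_def V_def X_def Y_def)
  \<comment> \<open>The contributions of \<open>V\<close> have the same coefficient 1/(2n) and
    cancel.\<close>
  have difference: "?U n - ?P n = (1 / (2 * real n)) *\<^sub>R (C_mat ** G_mat v ** transpose C_mat)"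
    if "n \<ge> 1" for n
    unfolding unbiased[OF that] paired[OF that]
    by (rule matrix_eqI_inner)
      (simp add: matrix_vector_mul_assoc [symmetric] matrix_vector_mult_diff_rdistrib
        matrix_vector_mult_diff_distrib scaleR_matrix_vector_mult matrix_vector_mult_scaleR
        inner_diff_right algebra_simps del: transpose_matrix_vector)
  have "confidence_ellipsoid (beta_star v) (?P n) \<alpha> \<subseteq> confidence_ellipsoid (beta_star v) (?U n) \<alpha>"
    if "n \<ge> 1" "psd (G_mat v)" for n \<alpha>
    using psd[OF that(1)] difference[OF that(1)] psd_conjugate[OF that(2)]
    by (intro confidence_ellipsoid_mono) simp_all
  then have "\<forall>\<^sub>F n in sequentially. psd (G_mat v) \<longrightarrow> (\<forall>\<alpha>\<in>{0<..<1}.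
      confidence_ellipsoid (beta_star v) (?P n) \<alpha> \<subseteq> confidence_ellipsoid (beta_star v) (?U n) \<alpha>)"
    unfolding eventually_sequentially by blast
  with difference show ?thesis
    by blast
qed

end
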